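(* Suppose the following assumptions hold: (i) $w^\dagger$ is the unique solution of $\min_{w\in\mathbb{R}^p} R_\alpha(w)$ subject to $Xw=y^\dagger$, and the noiseless dual gradient descent iterates $v_0^{(k)}$ satisfy $v_0^{(k)}\to v^\dagger$ as $k\to\infty$, where $v^\dagger$ is a solution of the noiseless dual problem $\min_{v\in\mathbb{R}^n} R_\alpha^*(-X^\top v)+\langle y^\dagger,v\rangle$; (ii) (nondegenerate source condition) $z^\dagger:=-X^\top v^\dagger\in \mathrm{ri}(\partial R_\alpha(w^\dagger))$; (iii) $R$ is partly smooth at $w^\dagger$ relative to a set $\mathcal{M}_{w^\dagger}\subset\mathbb{R}^p$; (iv) given $\epsilon>0$, with $\mathcal{U}_\epsilon=\bigcup_{w\in\mathcal{M}_{w^\dagger}\cap\mathcal{B}(w^\dagger,\epsilon)}(w+\partial R_\alpha(w))$, the strong convexity constant $\alpha$ is chosen such that $$\alpha\, c_\delta\,\|X\|^{-1}<\mathrm{dist}\big(w^\dagger+z^\dagger,\ \mathrm{bdy}(\mathcal{U}_\epsilon)\big),$$ where $c_\delta$ is the constant attached to the stopping time of (non-accelerated) dual gradient descent. Let $k_\delta$ be the optimal early stopping time of accelerated dual gradient descent (ADGD), and $w_\delta^{(k_\delta)}$ the corresponding ADGD iterate. Then, if $\delta>0$ is sufficiently small, there exists $\theta_\delta$ such that, if the ADGD parameter satisfies $\theta>\theta_\delta$, $$w_\delta^{(k_\delta)}\in\mathcal{M}_{w^\dagger}.$$ Moreover, there exist $0<\underline{k}<k_\delta<\overline{k}$ such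 that the ADGD iterates satisfy $w_\delta^{(k)}\in\mathcal{M}_{w^\dagger}$ for all $k\in\,]\underline{k},\overline{k}[$.
   Context: Setting. $X\in\mathbb{R}^{n\times p}$ is a nonzero matrix, $\|X\|$ its operator norm, $w^\dagger\in\mathbb{R}^p$, $y^\dagger=Xw^\dagger$. For each noise level $\delta\in(0,1)$, $y_\delta\in\mathbb{R}^n$ is a noisy observation in the range of $X$ with $\|y_\delta-y^\dagger\|\le\delta$; for $\delta=0$, $y_0=y^\dagger$. $R:\mathbb{R}^p\to\mathbb{R}\cup\{+\infty\}$ is proper, convex and lower semicontinuous; for $\alpha>0$, $R_\alpha(w)=R(w)+\frac{\alpha}{2}\|w\|^2$. The problem to be solved from noisy data is $\min_w R_\alpha(w)$ subject to $Xw=y_\delta$, with dual $\min_v R_\alpha^*(-X^\top v)+\langle y_\delta,v\rangle$. $R_\alpha^*$ is the convex conjugate of $R_\alpha$, $\partial$ the convex subdifferential, $\mathrm{prox}_{\gamma R}(w)=\arg\min_{w'}\{R(w')+\frac1{2\gamma}\|w'-w\|^2\}$, $\mathrm{ri}$ the relative interior, $\mathrm{bdy}$ the topological boundary, $\mathrm{dist}$ the Euclidean distance from a point to a set, $\mathcal{B}(w,\epsilon)$ the open ball. Throughout $\gamma=\alpha\|X\|^{-2}$. Dual gradient descent (DGD), used in (i) and (iv). $v_\delta^{(0)}=0$ and, for $k\ge0$, $w_\delta^{(k)}=\mathrm{prox}_{\alpha^{-1}R}(-\alpha^{-1}X^\top v_\delta^{(k)})$, $v_\delta^{(k+1)}=v_\delta^{(k)}+\gamma(Xw_\delta^{(k)}-y_\delta)$;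 the noiseless iterates $v_0^{(k)}$ in (i) are those with $\delta=0$ ($y_0=y^\dagger$). Constant $c_\delta$ (used in (iv)). For DGD, with $a=2\|X\|^{-1}$ and $b=\|X\|\,\|v^\dagger\|\,\alpha^{-1}$, for any $c\ge\delta$ and any stopping time $k^{\mathrm{DGD}}_\delta\in\{\lfloor c\delta^{-1}\rfloor,\dots,2\lfloor c\delta^{-1}\rfloor\}$, the DGD iterate at that time is at distance at most $\big(a(c^{1/2}+1)+bc^{-1/2}\big)\delta^{1/2}$ from $w^\dagger$. The constant $c_\delta>0$ is defined by $k^{\mathrm{DGD}}_\delta=c_\delta\delta^{-1}$. ADGD (used in the conclusions). Parameter $\theta>2$, initialization $v_\delta^{(0)}=u_\delta^{(-1)}=u_\delta^{(0)}=0\in\mathbb{R}^n$. For $k=0,1,2,\dots$: $r_\delta^{(k)}=\mathrm{prox}_{\alpha^{-1}R}(-\alpha^{-1}X^\top v_\delta^{(k)})$; $u_\delta^{(k)}=v_\delta^{(k)}+\gamma(Xr_\delta^{(k)}-y_\delta)$ (so the initial value of $u_\delta^{(0)}$ is overwritten at $k=0$); $v_\delta^{(k+1)}=u_\delta^{(k)}+\frac{k-1}{k+\theta}(u_\delta^{(k)}-u_\delta^{(k-1)})$; $w_\delta^{(k)}=\mathrm{prox}_{\alpha^{-1}R}(-\alpha^{-1}X^\top u_\delta^{(k)})$. The (optimal) early stopping time of ADGD is $k_\delta=\lceil c'\delta^{-1/2}\rceil$ for some constant $c'>0$. Partial smoothness. For $w$ with $\partial R(w)\neq\emptyset$, $T_w=(\mathrm{span}(\partial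 R(w)))^\perp$, where for a closed convex set $S$, $\mathrm{span}(S)$ denotes the smallest linear subspace containing $S-x$ for all $x\in S$. $R$ is partly smooth at $w^\dagger$ (with $\partial R(w^\dagger)\ne\emptyset$) relative to a set $\mathcal{M}_{w^\dagger}\ni w^\dagger$ if: (Smoothness) $\mathcal{M}_{w^\dagger}$ is a $C^2$ manifold around $w^\dagger$ and $R|_{\mathcal{M}_{w^\dagger}}$ is $C^2$ near $w^\dagger$; (Sharpness) the tangent space of $\mathcal{M}_{w^\dagger}$ at $w^\dagger$ equals $T_{w^\dagger}$; (Continuity) the set-valued map $\partial R$ is continuous near $w^\dagger$ along $\mathcal{M}_{w^\dagger}$. *)

theory Defs
  imports "HOL-Analysis.Analysis"
begin

section \<open>Convex analysis for functions with values in the extended reals\<close>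

definition proper_fun :: "('a \<Rightarrow> ereal) \<Rightarrow> bool" where
  "proper_fun f \<longleftrightarrow> (\<forall>x. f x \<noteq> -\<infinity>) \<and> (\<exists>x. f x \<noteq> \<infinity>)"

text \<open>In \<^typ>\<open>ereal\<close>, \<open>0 * \<infinity> = 0\<close>, so the endpoint cases below are harmless.\<close>

definition convex_fun :: "('a::real_vector \<Rightarrow> ereal) \<Rightarrow> bool" where
  "convex_fun f \<longleftrightarrow>
     (\<forall>x y u v. 0 \<le> u \<and> 0 \<le> v \<and> u + v = 1 \<longrightarrow>
        f (u *\<^sub>R x + v *\<^sub>R y) \<le> ereal u * f x + ereal v * f y)"

definition lsc_fun :: "('a::topological_space \<Rightarrow> ereal) \<Rightarrow> bool" where
  "lsc_fun f \<longleftrightarrow> (\<forall>x. f x \<le> Liminf (at x) f)"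

text \<open>For a proper function the subdifferential is empty outside the effective domain.\<close>

definition subdiff :: "('a::real_inner \<Rightarrow> ereal) \<Rightarrow> 'a \<Rightarrow> 'a set" where
  "subdiff f w = {z. \<forall>w'. f w + ereal (z \<bullet> (w' - w)) \<le> f w'}"

definition conjugate :: "('a::real_inner \<Rightarrow> ereal) \<Rightarrow> 'a \<Rightarrow> ereal" where
  "conjugate f z = (SUP w. ereal (z \<bullet> w) - f w)"

definition prox :: "real \<Rightarrow> ('a::real_inner \<Rightarrow> ereal) \<Rightarrow> 'a \<Rightarrow> 'a" where
  "prox \<gamma> f w = arg_min (\<lambda>w'. f w' + ereal (1 / (2 * \<gamma>) * (norm (w' - w))\<^sup>2)) (\<lambda>_. True)"

definition regularized :: "('a::real_inner \<Rightarrow> ereal) \<Rightarrow> real \<Rightarrow> 'a \<Rightarrow> ereal" where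
  "regularized R \<alpha> w = R w + ereal (\<alpha> / 2 * (norm w)\<^sup>2)"

text \<open>
  Distance to a set with the convention that the distance to the empty set is \<open>\<infinity>\<close>;
  the library's \<^const>\<open>infdist\<close> and \<^const>\<open>setdist\<close> return \<open>0\<close> there, which would
  be wrong for the distance to an empty boundary.
\<close>

definition edist_set :: "'a::metric_space \<Rightarrow> 'a set \<Rightarrow> ereal" where
  "edist_set x S = (INF y\<in>S. ereal (dist x y))"

section \<open>Partial smoothness\<close>

definition C2_on :: "('a::real_normed_vector \<Rightarrow> 'b::real_normed_vector) \<Rightarrow> 'a set \<Rightarrow> bool" where
  "C2_on f U \<longleftrightarrow>
     (\<exists>(f' :: 'a \<Rightarrow> 'a \<Rightarrow>\<^sub>L 'b) (f'' :: 'a \<Rightarrow> 'a \<Rightarrow>\<^sub>L ('a \<Rightarrow>\<^sub>L 'b)).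
        (\<forall>x\<in>U. (f has_derivative blinfun_apply (f' x)) (at x) \<and>
               (f' has_derivative blinfun_apply (f'' x)) (at x)) \<and>
        continuous_on U f'')"

text \<open>
  Embedded \<open>C\<^sup>2\<close> manifold around a point: near \<open>x\<close>, \<open>M\<close> is the zero set of a \<open>C\<^sup>2\<close> map
  whose derivative at \<open>x\<close> is onto. The codimension is not known in advance, so the target
  space is a linear subspace \<open>L\<close> of the ambient space instead of a type.
\<close>

definition C2_manifold_around :: "'a::euclidean_space set \<Rightarrow> 'a \<Rightarrow> bool" where
  "C2_manifold_around M x \<longleftrightarrow>
     (\<exists>U L (F :: 'a \<Rightarrow> 'a) F'. open U \<and> x \<in> U \<and> subspace L \<and> C2_on F U \<and> F ` U \<subseteq> L \<and>
        (F has_derivative F') (at x) \<and> range F' = L \<and>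
        x \<in> M \<and> M \<inter> U = {w \<in> U. F w = 0})"

definition tangent_space :: "'a::euclidean_space set \<Rightarrow> 'a \<Rightarrow> 'a set" where
  "tangent_space M x =
     {h. \<exists>e>0. \<exists>g :: real \<Rightarrow> 'a. g C1_differentiable_on {-e<..<e} \<and> g ` {-e<..<e} \<subseteq> M \<and>
           g 0 = x \<and> (g has_vector_derivative h) (at 0)}"

text \<open>A function is \<open>C\<^sup>2\<close> along \<open>M\<close> near \<open>x\<close> if it has a real-valued \<open>C\<^sup>2\<close> local extension.\<close>

definition C2_along_near :: "('a::euclidean_space \<Rightarrow> ereal) \<Rightarrow> 'a set \<Rightarrow> 'a \<Rightarrow> bool" where
  "C2_along_near f M x \<longleftrightarrow>
     (\<exists>U (h :: 'a \<Rightarrow> real). open U \<and> x \<in> U \<and> C2_on h U \<and> (\<forall>w\<in>M \<inter> U. f w = ereal (h w)))"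

text \<open>
  Continuity of a set-valued map at \<open>x\<close> relative to \<open>M\<close>, in the sense of Painleve-Kuratowski:
  outer and inner semicontinuity, respectively.
\<close>

definition setvalued_cont_at :: "('a::metric_space \<Rightarrow> 'b::metric_space set) \<Rightarrow> 'a set \<Rightarrow> 'a \<Rightarrow> bool" where
  "setvalued_cont_at S M x \<longleftrightarrow>
     (\<forall>\<xi>. (\<forall>n. \<xi> n \<in> M) \<and> \<xi> \<longlonglongrightarrow> x \<longrightarrow>
        (\<forall>\<eta> u. (\<forall>n::nat. \<eta> n \<in> S (\<xi> n)) \<and> \<eta> \<longlonglongrightarrow> u \<longrightarrow> u \<in> S x) \<and>
        (\<forall>u\<in>S x. \<exists>\<eta>. (\<forall>\<^sub>F n in sequentially. \<eta> n \<in> S (\<xi> n)) \<and> \<eta> \<longlonglongrightarrow> u))"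

text \<open>The space \<open>T\<^sub>w\<close>: the linear span of a set translated to the origin, complemented.\<close>

definition T_space :: "('a::euclidean_space \<Rightarrow> ereal) \<Rightarrow> 'a \<Rightarrow> 'a set" where
  "T_space f w = (span {a - b | a b. a \<in> subdiff f w \<and> b \<in> subdiff f w})\<^sup>\<bottom>"

definition partly_smooth :: "('a::euclidean_space \<Rightarrow> ereal) \<Rightarrow> 'a \<Rightarrow> 'a set \<Rightarrow> bool" where
  "partly_smooth f w M \<longleftrightarrow>
     w \<in> M \<and> subdiff f w \<noteq> {} \<and>
     C2_manifold_around M w \<and> C2_along_near f M w \<and>
     tangent_space M w = T_space f w \<and>
     (\<exists>e>0. \<forall>x\<in>M \<inter> ball w e. setvalued_cont_at (subdiff f) M x)"

section \<open>Dual gradient descent, plain and accelerated\<close>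

text \<open>
  \<open>primal_of\<close> maps a dual variable to its primal variable; \<open>dual_step\<close> is the gradient step
  with step size \<open>\<gamma> = \<alpha> \<parallel>X\<parallel>\<^sup>-\<^sup>2\<close>, where \<open>\<parallel>X\<parallel>\<close> is the operator norm.
\<close>

definition primal_of :: "(real^'p \<Rightarrow> ereal) \<Rightarrow> real \<Rightarrow> real^'p^'n \<Rightarrow> real^'n \<Rightarrow> real^'p" where
  "primal_of R \<alpha> X v = prox (1 / \<alpha>) R (- (1 / \<alpha>) *\<^sub>R (transpose X *v v))"

definition dual_step ::
    "(real^'p \<Rightarrow> ereal) \<Rightarrow> real \<Rightarrow> real^'p^'n \<Rightarrow> real^'n \<Rightarrow> real^'n \<Rightarrow> real^'n" where
  "dual_step R \<alpha> X y v =
     v + (\<alpha> / (onorm ((*v) X))\<^sup>2) *\<^sub>R (X *v primal_of R \<alpha> X v - y)"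

primrec dgd_v :: "(real^'p \<Rightarrow> ereal) \<Rightarrow> real \<Rightarrow> real^'p^'n \<Rightarrow> real^'n \<Rightarrow> nat \<Rightarrow> real^'n" where
  "dgd_v R \<alpha> X y 0 = 0"
| "dgd_v R \<alpha> X y (Suc k) = dual_step R \<alpha> X y (dgd_v R \<alpha> X y k)"

text \<open>
  The recursion \<open>v\<^sub>k\<^sub>+\<^sub>1 = u\<^sub>k + ((k - 1) / (k + \<theta>)) (u\<^sub>k - u\<^sub>k\<^sub>-\<^sub>1)\<close> with \<open>u\<^sub>k\<close> the gradient step at
  \<open>v\<^sub>k\<close>; the case \<open>k = 0\<close> is separate because \<open>u\<^sub>-\<^sub>1 = 0\<close> is not a gradient step. Its momentum
  coefficient is \<open>-1 / \<theta>\<close>, not \<open>0\<close>.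
\<close>

fun adgd_v ::
    "(real^'p \<Rightarrow> ereal) \<Rightarrow> real \<Rightarrow> real^'p^'n \<Rightarrow> real^'n \<Rightarrow> real \<Rightarrow> nat \<Rightarrow> real^'n" where
  "adgd_v R \<alpha> X y \<theta> 0 = 0"
| "adgd_v R \<alpha> X y \<theta> (Suc 0) =
     (let u = dual_step R \<alpha> X y (adgd_v R \<alpha> X y \<theta> 0)
      in u + ((0 - 1) / (0 + \<theta>)) *\<^sub>R (u - 0))"
| "adgd_v R \<alpha> X y \<theta> (Suc (Suc k)) =
     (let u = dual_step R \<alpha> X y (adgd_v R \<alpha> X y \<theta> (Suc k));
          u_prev = dual_step R \<alpha> X y (adgd_v R \<alpha> X y \<theta> k)
      in u + ((real (Suc k) - 1) / (real (Suc k) + \<theta>)) *\<^sub>R (u - u_prev))"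

definition adgd_u ::
    "(real^'p \<Rightarrow> ereal) \<Rightarrow> real \<Rightarrow> real^'p^'n \<Rightarrow> real^'n \<Rightarrow> real \<Rightarrow> nat \<Rightarrow> real^'n" where
  "adgd_u R \<alpha> X y \<theta> k = dual_step R \<alpha> X y (adgd_v R \<alpha> X y \<theta> k)"

definition adgd_w ::
    "(real^'p \<Rightarrow> ereal) \<Rightarrow> real \<Rightarrow> real^'p^'n \<Rightarrow> real^'n \<Rightarrow> real \<Rightarrow> nat \<Rightarrow> real^'p" where
  "adgd_w R \<alpha> X y \<theta> k = primal_of R \<alpha> X (adgd_u R \<alpha> X y \<theta> k)"

definition adgd_stop :: "real \<Rightarrow> real \<Rightarrow> nat" where
  "adgd_stop c' \<delta> = nat \<lceil>c' * \<delta> powr (-1/2)\<rceil>"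

definition U_set :: "('a::euclidean_space \<Rightarrow> ereal) \<Rightarrow> real \<Rightarrow> 'a set \<Rightarrow> 'a \<Rightarrow> real \<Rightarrow> 'a set" where
  "U_set R \<alpha> M w\<^sub>0 \<epsilon> = (\<Union>w\<in>M \<inter> ball w\<^sub>0 \<epsilon>. (\<lambda>g. w + g) ` subdiff (regularized R \<alpha>) w)"

end

(*
  The distance condition forces wdag + zdag, a point of U_set, into the interior of U_set.
  Since w + z for z in the subdifferential of R_alpha at w determines w, every dual point v
  near vdag has its primal point in M. At the stopping time ceiling (c' / sqrt delta) the plain
  gradient iterates are near vdag: the gradient step is nonexpansive, so the noise contributes
  at most k * gamma * delta, which is of order sqrt delta. Finally, as theta tends to infinity
  the momentum coefficients vanish and the k-th accelerated iterate tends to the plain one.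
*)

theory Submission
  imports Defs "HOL-Real_Asymp.Real_Asymp"
begin

section \<open>Subdifferentials\<close>

lemma subdiff_finite:
  assumes "proper_fun f" "z \<in> subdiff f w"
  shows "\<bar>f w\<bar> \<noteq> \<infinity>"
proof -
  obtain x where "f x \<noteq> \<infinity>" using assms(1) by (auto simp: proper_fun_def)
  moreover have "f w + ereal (z \<bullet> (x - w)) \<le> f x" using assms(2) by (auto simp: subdiff_def)
  ultimately have "f w \<noteq> \<infinity>" by auto
  then show ?thesis using assms(1) by (auto simp: proper_fun_def)
qed

lemma subdiff_monotone:
  assumes f: "proper_fun f" and a: "a \<in> subdiff f x" and b: "b \<in> subdiff f y"
  shows "0 \<le> (a - b) \<bullet> (x - y)"
proof -
  obtain r s where r: "f x = ereal r" and s: "f y = ereal s"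
    using subdiff_finite[OF f a] subdiff_finite[OF f b] by auto
  have "f x + ereal (a \<bullet> (y - x)) \<le> f y" "f y + ereal (b \<bullet> (x - y)) \<le> f x"
    using a b by (auto simp: subdiff_def)
  then have "r + a \<bullet> (y - x) \<le> s" "s + b \<bullet> (x - y) \<le> r" by (simp_all add: r s)
  then show ?thesis by (simp add: inner_diff_left inner_diff_right)
qed

text \<open>Equal sums make \<open>a - b\<close> the negative of \<open>x - y\<close>, so
  monotonicity bounds the squared distance of \<open>x\<close> and \<open>y\<close> by 0. With it
  the base point can be read off from a point of \<open>U_set\<close>.\<close>

lemma subdiff_add_inj:
  assumes f: "proper_fun f" and a: "a \<in> subdiff f x" and b: "b \<in> subdiff f y"
    and eq: "x + a = y + b"
  shows "x = y"
proof -
  have "a - b = - (x - y)" using eq by (simp add: algebra_simps)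
  then have "(a - b) \<bullet> (x - y) = - ((x - y) \<bullet> (x - y))" by (simp only: inner_minus_left)
  with subdiff_monotone[OF f a b] have "(x - y) \<bullet> (x - y) \<le> 0" by linarith
  then show ?thesis by (metis inner_ge_zero inner_eq_zero_iff order_antisym right_minus_eq)
qed

lemma proper_regularized: "proper_fun R \<Longrightarrow> proper_fun (regularized R \<alpha>)"
  by (auto simp: proper_fun_def regularized_def)

text \<open>The quadratic of \<open>regularized\<close> is expanded exactly about \<open>w\<close>:
  its linear part turns a subgradient of \<open>R\<close> into \<open>z\<close>, and its
  second-order part is kept as the strong convexity gain.\<close>

lemma regularized_growth:
  assumes z: "z - \<alpha> *\<^sub>R w \<in> subdiff R w"
  shows "regularized R \<alpha> w + ereal (z \<bullet> (x - w) + \<alpha> / 2 * (norm (x - w))\<^sup>2) \<le> regularized R \<alpha> x"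
proof -
  have *: "R w + ereal ((z - \<alpha> *\<^sub>R w) \<bullet> (x - w)) \<le> R x" using z by (auto simp: subdiff_def)
  have eq: "\<alpha> / 2 * (norm w)\<^sup>2 + (z \<bullet> (x - w) + \<alpha> / 2 * (norm (x - w))\<^sup>2)
      = (z - \<alpha> *\<^sub>R w) \<bullet> (x - w) + \<alpha> / 2 * (norm x)\<^sup>2"
    by (simp add: power2_norm_eq_inner inner_diff_left inner_diff_right inner_commute algebra_simps)
  \<comment> \<open>\<open>R\<close> may take infinite values, so the real identity
    \<open>eq\<close> enters by regrouping sums, never by cancelling.\<close>
  have "regularized R \<alpha> w + ereal (z \<bullet> (x - w) + \<alpha> / 2 * (norm (x - w))\<^sup>2)
      = R w + ereal (\<alpha> / 2 * (norm w)\<^sup>2 + (z \<bullet> (x - w) + \<alpha> / 2 * (norm (x - w))\<^sup>2))"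
    by (simp only: regularized_def plus_ereal.simps(1)[symmetric] add.assoc)
  also have "\<dots> = (R w + ereal ((z - \<alpha> *\<^sub>R w) \<bullet> (x - w))) + ereal (\<alpha> / 2 * (norm x)\<^sup>2)"
    unfolding eq by (simp only: plus_ereal.simps(1)[symmetric] add.assoc)
  also have "\<dots> \<le> regularized R \<alpha> x" unfolding regularized_def by (intro add_right_mono *)
  finally show ?thesis .
qed

lemma subdiff_regularizedI:
  assumes "0 \<le> \<alpha>" and z: "z - \<alpha> *\<^sub>R w \<in> subdiff R w"
  shows "z \<in> subdiff (regularized R \<alpha>) w"
  unfolding subdiff_def
proof (intro CollectI allI)
  fix x
  have "regularized R \<alpha> w + ereal (z \<bullet> (x - w))
      \<le> regularized R \<alpha> w + ereal (z \<bullet> (x - w) + \<alpha> / 2 * (norm (x - w))\<^sup>2)"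
    using assms(1) by (intro add_left_mono) simp
  then show "regularized R \<alpha> w + ereal (z \<bullet> (x - w)) \<le> regularized R \<alpha> x"
    using regularized_growth[OF z] by (rule order_trans)
qed

section \<open>The proximal map\<close>

text \<open>Minimizing sequences are Cauchy by the parallelogram law, so no compactness is needed.\<close>

lemma is_arg_min_prox:
  fixes f :: "'a::{real_inner,complete_space} \<Rightarrow> ereal"
  assumes f: "proper_fun f" "convex_fun f" "lsc_fun f"
    and s: "s \<in> subdiff f x0" and \<gamma>: "0 < \<gamma>"
  shows "is_arg_min (\<lambda>w'. f w' + ereal (1 / (2 * \<gamma>) * (norm (w' - w))\<^sup>2)) (\<lambda>_. True) (prox \<gamma> f w)"
proof -
  define q where "q x = 1 / (2 * \<gamma>) * (norm (x - w))\<^sup>2" for x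
  define g where "g x = f x + ereal (q x)" for x
  obtain r where r: "f x0 = ereal r" using subdiff_finite[OF f(1) s] by auto
  have ninf: "f x \<noteq> -\<infinity>" for x using f(1) by (auto simp: proper_fun_def)
  \<comment> \<open>The subgradient gives an affine minorant of \<open>f\<close>; adding
    \<open>q\<close> and completing the square, with minimum at
    \<open>w - \<gamma> *\<^sub>R s\<close>, yields this constant.\<close>
  have lower: "ereal (r + s \<bullet> (w - x0) - \<gamma> / 2 * (norm s)\<^sup>2) \<le> g x" for x
  proof (cases "f x")
    case (real a)
    have "f x0 + ereal (s \<bullet> (x - x0)) \<le> f x" using s by (auto simp: subdiff_def)
    then have 1: "r + s \<bullet> (x - x0) \<le> a" by (simp add: r real)
    have sq: "(norm (\<gamma> *\<^sub>R s + d))\<^sup>2 = \<gamma>\<^sup>2 * (norm s)\<^sup>2 + 2 * \<gamma> * (s \<bullet> d) + (norm d)\<^sup>2" for d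
      by (simp only: power2_norm_eq_inner)
        (simp add: inner_add_left inner_add_right inner_commute power2_eq_square algebra_simps)
    have "0 \<le> 1 / (2 * \<gamma>) * (norm (\<gamma> *\<^sub>R s + (x - w)))\<^sup>2" using \<gamma> by simp
    also have "\<dots> = \<gamma> / 2 * (norm s)\<^sup>2 + s \<bullet> (x - w) + q x"
      unfolding q_def sq using \<gamma> by (simp add: field_simps power2_eq_square)
    finally show ?thesis using 1 by (simp add: g_def real inner_diff_right)
  qed (use ninf in \<open>auto simp: g_def\<close>)
  define m where "m = (INF x. g x)"
  have "m \<le> g x0" unfolding m_def by (rule INF_lower) simp
  moreover have "ereal (r + s \<bullet> (w - x0) - \<gamma> / 2 * (norm s)\<^sup>2) \<le> m"
    unfolding m_def by (intro INF_greatest lower)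
  ultimately obtain \<mu> where \<mu>: "m = ereal \<mu>"
    by (cases m) (auto simp: g_def r)
  have m_le: "ereal \<mu> \<le> g x" for x unfolding \<mu>[symmetric] m_def by (rule INF_lower) simp
  define \<eta> where "\<eta> n = 1 / real (Suc n)" for n
  have \<eta>: "\<eta> \<longlonglongrightarrow> 0" unfolding \<eta>_def by real_asymp
  have "\<exists>x. g x < ereal (\<mu> + \<eta> n)" for n
  proof -
    have "m < ereal (\<mu> + \<eta> n)" by (simp add: \<mu> \<eta>_def)
    then show ?thesis unfolding m_def INF_less_iff by auto
  qed
  then obtain x where x: "\<And>n. g (x n) < ereal (\<mu> + \<eta> n)" by metis
  have "\<exists>a. f (x n) = ereal a" for n
    using x[of n] ninf[of "x n"] by (cases "f (x n)") (auto simp: g_def)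
  then obtain a where a: "\<And>n. f (x n) = ereal (a n)" by metis
  have x': "a n + q (x n) < \<mu> + \<eta> n" for n using x[of n] by (simp add: g_def a)
  have dist_x: "(norm (x i - x j))\<^sup>2 \<le> 4 * \<gamma> * (\<eta> i + \<eta> j)" for i j
  proof -
    define p where "p = (1/2) *\<^sub>R x i + (1/2) *\<^sub>R x j"
    have "f p \<le> ereal (1/2) * f (x i) + ereal (1/2) * f (x j)"
      using f(2) unfolding convex_fun_def p_def by (metis field_sum_of_halves zero_le_divide_1_iff zero_le_numeral)
    then have fp: "f p \<le> ereal (a i / 2 + a j / 2)" by (simp add: a)
    have "ereal \<mu> \<le> f p + ereal (q p)" using m_le[of p] by (simp add: g_def)
    also have "\<dots> \<le> ereal (a i / 2 + a j / 2) + ereal (q p)" by (intro add_right_mono fp)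
    finally have 1: "\<mu> \<le> a i / 2 + a j / 2 + q p" by simp
    have "p - w = (1/2) *\<^sub>R ((x i - w) + (x j - w))"
      by (simp add: p_def algebra_simps flip: scaleR_add_left)
    moreover have "x i - x j = (x i - w) - (x j - w)" by simp
    moreover have "(norm ((1/2) *\<^sub>R (u + v)))\<^sup>2 = (norm u)\<^sup>2 / 2 + (norm v)\<^sup>2 / 2 - (norm (u - v))\<^sup>2 / 4"
      for u v :: 'a
      by (simp only: power2_norm_eq_inner)
        (simp add: inner_add_left inner_add_right inner_diff_left inner_diff_right inner_commute field_simps)
    ultimately have "(norm (p - w))\<^sup>2 =
        (norm (x i - w))\<^sup>2 / 2 + (norm (x j - w))\<^sup>2 / 2 - (norm (x i - x j))\<^sup>2 / 4"
      by (simp only:)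
    \<comment> \<open>\<open>D\<close> is the amount by which \<open>q\<close> at the midpoint lies
      below the mean of its end values. The objective at the midpoint is still at least
      \<open>\<mu>\<close>, so convexity of \<open>f\<close> bounds \<open>D\<close> by the mean of
      the two slacks.\<close>
    moreover define D where "D = (norm (x i - x j))\<^sup>2 / (8 * \<gamma>)"
    ultimately have "q p = q (x i) / 2 + q (x j) / 2 - D"
      unfolding q_def by (simp only:) (simp add: algebra_simps add_divide_distrib diff_divide_distrib)
    then have "D \<le> (\<eta> i + \<eta> j) / 2" using 1 x'[of i] x'[of j] by argo
    then have "(norm (x i - x j))\<^sup>2 \<le> (\<eta> i + \<eta> j) / 2 * (8 * \<gamma>)"
      unfolding D_def using \<gamma> by (subst (asm) pos_divide_le_eq) auto
    also have "\<dots> = 4 * \<gamma> * (\<eta> i + \<eta> j)" by simp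
    finally show ?thesis .
  qed
  have "Cauchy x"
  proof (rule metric_CauchyI)
    fix e :: real assume e: "0 < e"
    have "\<forall>\<^sub>F n in sequentially. \<eta> n < e\<^sup>2 / (8 * \<gamma>)"
      using e \<gamma> by (intro order_tendstoD(2)[OF \<eta>]) simp
    then obtain N where N: "\<And>n. n \<ge> N \<Longrightarrow> \<eta> n < e\<^sup>2 / (8 * \<gamma>)"
      unfolding eventually_sequentially by blast
    have "dist (x i) (x j) < e" if "i \<ge> N" "j \<ge> N" for i j
    proof -
      have "\<eta> i + \<eta> j < 2 * (e\<^sup>2 / (8 * \<gamma>))" using N[OF that(1)] N[OF that(2)] by linarith
      then have "4 * \<gamma> * (\<eta> i + \<eta> j) < 4 * \<gamma> * (2 * (e\<^sup>2 / (8 * \<gamma>)))"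
        using \<gamma> by (intro mult_strict_left_mono) auto
      also have "\<dots> = e\<^sup>2" using \<gamma> by simp
      finally have "(norm (x i - x j))\<^sup>2 < e\<^sup>2" using dist_x[of i j] by linarith
      then show ?thesis unfolding dist_norm by (rule power2_less_imp_less) (use e in simp)
    qed
    then show "\<exists>N. \<forall>i\<ge>N. \<forall>j\<ge>N. dist (x i) (x j) < e" by blast
  qed
  then obtain l where l: "x \<longlonglongrightarrow> l" using Cauchy_convergent convergent_def by blast
  have "g l \<le> ereal \<mu>"
  proof (rule ccontr)
    assume "\<not> g l \<le> ereal \<mu>"
    then have "ereal (\<mu> - q l) < f l"
      using ninf[of l] by (cases "f l") (auto simp: g_def)
    \<comment> \<open>A level \<open>b\<close> strictly in between persists near \<open>l\<close> by
      lower semicontinuity. Along the sequence it gives \<open>b + q l \<le> \<mu>\<close> in the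
      limit, contrary to its choice.\<close>
    then obtain b where b: "ereal (\<mu> - q l) < ereal b" "ereal b < f l"
      using ereal_dense2 by blast
    have "ereal b < Liminf (at l) f" using b(2) f(3) unfolding lsc_fun_def by (metis less_le_trans)
    then have "\<forall>\<^sub>F x in at l. ereal b < f x" using less_LiminfD by blast
    \<comment> \<open>\<open>Liminf (at l)\<close> ignores the point \<open>l\<close> itself, which
      the sequence may hit; there the bound is \<open>b < f l\<close>.\<close>
    then have "\<forall>\<^sub>F x in nhds l. ereal b < f x"
      using b(2) by (auto simp: eventually_at_filter elim: eventually_mono)
    then have "\<forall>\<^sub>F n in sequentially. ereal b < f (x n)"
      using l by (auto simp: filterlim_iff)
    then have ev: "\<forall>\<^sub>F n in sequentially. b + q (x n) \<le> \<mu> + \<eta> n"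
    proof eventually_elim
      case (elim n)
      then show ?case using x'[of n] by (simp add: a)
    qed
    have "(\<lambda>n. b + q (x n)) \<longlonglongrightarrow> b + q l" unfolding q_def by (intro tendsto_intros l)
    moreover have "(\<lambda>n. \<mu> + \<eta> n) \<longlonglongrightarrow> \<mu>" using tendsto_add[OF tendsto_const \<eta>] by simp
    ultimately have "b + q l \<le> \<mu>" using tendsto_le[OF sequentially_bot _ _ ev] by blast
    then show False using b(1) by simp
  qed
  then have "is_arg_min g (\<lambda>_. True) l"
    using m_le by (auto simp: is_arg_min_def not_less intro: order_trans)
  \<comment> \<open>\<open>arg_min\<close> is a choice operator, so one minimizer \<open>l\<close>
    is enough for the chosen point to be a minimizer.\<close>
  then have "is_arg_min g (\<lambda>_. True) (arg_min g (\<lambda>_. True))" unfolding arg_min_def by (rule someI)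
  then show ?thesis unfolding prox_def g_def q_def .
qed

text \<open>Fermat's rule by hand: the minimizer is compared with nearby points on the segment to
  \<open>x\<close>. Convexity bounds the change of \<open>f\<close> linearly in the parameter, and
  to first order only the derivative of the quadratic remains. The subgradient \<open>s\<close>
  ensures that the minimizer exists.\<close>

lemma prox_subdiff:
  fixes f :: "'a::{real_inner,complete_space} \<Rightarrow> ereal"
  assumes f: "proper_fun f" "convex_fun f" "lsc_fun f"
    and s: "s \<in> subdiff f x0" and \<gamma>: "0 < \<gamma>"
  shows "(1 / \<gamma>) *\<^sub>R (u - prox \<gamma> f u) \<in> subdiff f (prox \<gamma> f u)"
proof -
  define w where "w = prox \<gamma> f u"
  have opt: "f w + ereal (1 / (2 * \<gamma>) * (norm (w - u))\<^sup>2)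
      \<le> f x + ereal (1 / (2 * \<gamma>) * (norm (x - u))\<^sup>2)" for x
    using is_arg_min_prox[OF f s \<gamma>, of u] unfolding w_def is_arg_min_def by (auto simp: not_less)
  have ninf: "f x \<noteq> -\<infinity>" for x using f(1) by (auto simp: proper_fun_def)
  have "f w \<noteq> \<infinity>" using opt[of x0] subdiff_finite[OF f(1) s] by auto
  then obtain a where a: "f w = ereal a" using ninf[of w] by (cases "f w") auto
  have "f w + ereal (((1 / \<gamma>) *\<^sub>R (u - w)) \<bullet> (x - w)) \<le> f x" for x
  proof (cases "f x")
    case (real b)
    define d where "d = x - w"
    \<comment> \<open>The optimality inequality at \<open>w + t *\<^sub>R d\<close>, divided by
      \<open>t\<close>; its last summand vanishes as \<open>t\<close> tends to 0.\<close>
    have bound: "0 \<le> b - a + 1 / \<gamma> * ((w - u) \<bullet> d) + t * (1 / (2 * \<gamma>) * (norm d)\<^sup>2)"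
      if t: "0 < t" "t < 1" for t :: real
    proof -
      have "f ((1 - t) *\<^sub>R w + t *\<^sub>R x) \<le> ereal (1 - t) * f w + ereal t * f x"
        using f(2) t unfolding convex_fun_def
        by (metis diff_add_cancel diff_ge_0_iff_ge less_imp_le)
      also have "(1 - t) *\<^sub>R w + t *\<^sub>R x = w + t *\<^sub>R d" by (simp add: d_def algebra_simps)
      finally have "f (w + t *\<^sub>R d) \<le> ereal ((1 - t) * a + t * b)" by (simp add: a real)
      then have "f (w + t *\<^sub>R d) + ereal (1 / (2 * \<gamma>) * (norm (w + t *\<^sub>R d - u))\<^sup>2)
          \<le> ereal ((1 - t) * a + t * b) + ereal (1 / (2 * \<gamma>) * (norm (w + t *\<^sub>R d - u))\<^sup>2)"
        by (intro add_right_mono)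
      from order_trans[OF opt this] have "a + 1 / (2 * \<gamma>) * (norm (w - u))\<^sup>2
          \<le> (1 - t) * a + t * b + 1 / (2 * \<gamma>) * (norm (w + t *\<^sub>R d - u))\<^sup>2"
        by (simp add: a)
      moreover have "w + t *\<^sub>R d - u = (w - u) + t *\<^sub>R d" by simp
      then have "(norm (w + t *\<^sub>R d - u))\<^sup>2
          = (norm (w - u))\<^sup>2 + 2 * t * ((w - u) \<bullet> d) + t\<^sup>2 * (norm d)\<^sup>2"
        by (simp only: power2_norm_eq_inner)
          (simp add: inner_add_left inner_add_right inner_commute power2_eq_square algebra_simps)
      then have "1 / (2 * \<gamma>) * (norm (w + t *\<^sub>R d - u))\<^sup>2
          = 1 / (2 * \<gamma>) * (norm (w - u))\<^sup>2 + t * (1 / \<gamma> * ((w - u) \<bullet> d))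
            + t * (t * (1 / (2 * \<gamma>) * (norm d)\<^sup>2))"
        using \<gamma> by (simp only:) (simp add: field_simps power2_eq_square)
      moreover have "t * (b - a + 1 / \<gamma> * ((w - u) \<bullet> d) + t * (1 / (2 * \<gamma>) * (norm d)\<^sup>2))
          = ((1 - t) * a + t * b - a) + t * (1 / \<gamma> * ((w - u) \<bullet> d))
            + t * (t * (1 / (2 * \<gamma>) * (norm d)\<^sup>2))"
        by (simp only: distrib_left left_diff_distrib right_diff_distrib)
      ultimately have "0 \<le> t * (b - a + 1 / \<gamma> * ((w - u) \<bullet> d) + t * (1 / (2 * \<gamma>) * (norm d)\<^sup>2))"
        by linarith
      then show ?thesis using t by (simp add: zero_le_mult_iff)
    qed
    have "((\<lambda>t. b - a + 1 / \<gamma> * ((w - u) \<bullet> d) + t * (1 / (2 * \<gamma>) * (norm d)\<^sup>2))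
        \<longlongrightarrow> b - a + 1 / \<gamma> * ((w - u) \<bullet> d) + 0 * (1 / (2 * \<gamma>) * (norm d)\<^sup>2)) (at_right 0)"
      by (intro tendsto_intros)
    moreover have "\<forall>\<^sub>F t in at_right (0::real).
        0 \<le> b - a + 1 / \<gamma> * ((w - u) \<bullet> d) + t * (1 / (2 * \<gamma>) * (norm d)\<^sup>2)"
      using eventually_at_right_real[OF zero_less_one] by eventually_elim (rule bound, auto)
    ultimately have "0 \<le> b - a + 1 / \<gamma> * ((w - u) \<bullet> d) + 0 * (1 / (2 * \<gamma>) * (norm d)\<^sup>2)"
      by (intro tendsto_lowerbound) auto
    then have "a + 1 / \<gamma> * ((u - w) \<bullet> d) \<le> b"
      by (simp add: inner_diff_left algebra_simps diff_divide_distrib)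
    then show ?thesis by (simp add: a real d_def)
  qed (use ninf in auto)
  then show ?thesis by (simp add: subdiff_def w_def)
qed

section \<open>The dual gradient step\<close>

text \<open>The primal point depends on \<open>v\<close> alone, so the data enter a step only
  through the subtracted \<open>y\<close>.\<close>

lemma dual_step_noise:
  "norm (dual_step R \<alpha> X y v - dual_step R \<alpha> X y' v) = \<bar>\<alpha>\<bar> / (onorm ((*v) X))\<^sup>2 * norm (y - y')"
proof -
  have "dual_step R \<alpha> X y v - dual_step R \<alpha> X y' v = (\<alpha> / (onorm ((*v) X))\<^sup>2) *\<^sub>R (y' - y)"
    by (simp add: dual_step_def scaleR_diff_right)
  then show ?thesis by (simp add: norm_minus_commute)
qed

text \<open>The subgradient \<open>s\<close> at some point \<open>x0\<close> provides the affine
  minorant that makes every \<open>prox\<close> value a genuine minimizer.\<close>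

locale dual_problem =
  fixes R :: "real^'p \<Rightarrow> ereal" and \<alpha> :: real and X :: "real^'p^'n" and s x0 :: "real^'p"
  assumes R: "proper_fun R" "convex_fun R" "lsc_fun R"
    and \<alpha>: "0 < \<alpha>" and X: "X \<noteq> 0" and s: "s \<in> subdiff R x0"
begin

abbreviation "P \<equiv> primal_of R \<alpha> X"

lemma onorm_pos: "0 < onorm ((*v) X)"
proof -
  have "\<exists>v. X *v v \<noteq> 0" using X by (metis matrix_eq matrix_vector_mult_0)
  then show ?thesis using onorm_pos_lt[of "(*v) X"] by (simp add: matrix_vector_mul_bounded_linear)
qed

text \<open>Optimality of the prox with parameter \<open>1 / \<alpha>\<close>; the outer factor
  \<alpha> cancels the one inside. It expresses that \<open>P v\<close> minimizes the Lagrangian,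
  \<open>regularized R \<alpha> w\<close> plus the inner product of \<open>v\<close> and
  \<open>X *v w\<close>, over \<open>w\<close>.\<close>

lemma primal_subdiff: "- (transpose X *v v) - \<alpha> *\<^sub>R P v \<in> subdiff R (P v)"
  using prox_subdiff[OF R s, of "1 / \<alpha>" "- (1 / \<alpha>) *\<^sub>R (transpose X *v v)"] \<alpha>
  by (simp add: primal_of_def scaleR_diff_right)

lemma primal_subdiff_regularized: "- (transpose X *v v) \<in> subdiff (regularized R \<alpha>) (P v)"
  using subdiff_regularizedI[OF _ primal_subdiff] \<alpha> by simp

text \<open>Monotonicity of the subdifferential of \<open>R\<close>, with \<open>X\<close> moved
  across the inner product; the \<alpha> terms of the two subgradients supply the square. Up to
  sign, \<open>X *v P v\<close> is the gradient of the conjugate term of the dual objective.\<close>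

lemma primal_cocoercive: "(v - v') \<bullet> (X *v (P v - P v')) \<le> - \<alpha> * (norm (P v - P v'))\<^sup>2"
proof -
  have "0 \<le> (- (transpose X *v v) - \<alpha> *\<^sub>R P v - (- (transpose X *v v') - \<alpha> *\<^sub>R P v')) \<bullet> (P v - P v')"
    by (rule subdiff_monotone[OF R(1) primal_subdiff primal_subdiff])
  also have "\<dots> = - ((transpose X *v (v - v')) \<bullet> (P v - P v')) - \<alpha> * (norm (P v - P v'))\<^sup>2"
    by (simp add: power2_norm_eq_inner matrix_vector_mult_diff_distrib inner_diff_left
        inner_diff_right algebra_simps)
  also have "(transpose X *v (v - v')) \<bullet> (P v - P v') = (v - v') \<bullet> (X *v (P v - P v'))"
    by (simp add: dot_lmul_matrix transpose_matrix_vector)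
  finally show ?thesis by simp
qed

text \<open>Cocoercivity meets Cauchy-Schwarz, and one factor \<open>norm (P v - P v')\<close> is
  divided out; hence the separate case of equal primal points.\<close>

lemma primal_lipschitz: "norm (P v - P v') \<le> onorm ((*v) X) / \<alpha> * norm (v - v')"
proof (cases "P v = P v'")
  case False
  have "\<alpha> * (norm (P v - P v'))\<^sup>2 \<le> - ((v - v') \<bullet> (X *v (P v - P v')))"
    using primal_cocoercive[of v v'] by simp
  also have "\<dots> \<le> norm (v - v') * norm (X *v (P v - P v'))"
    using Cauchy_Schwarz_ineq2[of "v - v'" "X *v (P v - P v')"] by linarith
  also have "\<dots> \<le> norm (v - v') * (onorm ((*v) X) * norm (P v - P v'))"
    by (intro mult_left_mono onorm matrix_vector_mul_bounded_linear) simp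
  finally have "(\<alpha> * norm (P v - P v')) * norm (P v - P v')
      \<le> (onorm ((*v) X) * norm (v - v')) * norm (P v - P v')"
    by (simp add: power2_eq_square mult_ac)
  then have "\<alpha> * norm (P v - P v') \<le> onorm ((*v) X) * norm (v - v')"
    using False by (simp add: mult_le_cancel_right)
  then show ?thesis using \<alpha> by (simp add: field_simps)
qed (use onorm_pos \<alpha> in simp)

lemma continuous_primal: "continuous_on UNIV P"
proof (rule lipschitz_on_continuous_on)
  show "(onorm ((*v) X) / \<alpha>)-lipschitz_on UNIV P"
    using primal_lipschitz onorm_pos \<alpha> by (auto simp: lipschitz_on_def dist_norm)
qed

text \<open>In the expanded square the cross term is at most
  \<open>- 2 * \<gamma> * \<alpha> * (norm p)\<^sup>2\<close> by cocoercivity. The quadratic term is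
  at most half of that in size, because the step size satisfies
  \<open>\<gamma> * N\<^sup>2 = \<alpha>\<close>.\<close>

lemma dual_step_nonexpansive:
  "norm (dual_step R \<alpha> X y v - dual_step R \<alpha> X y v') \<le> norm (v - v')"
proof -
  define N where "N = onorm ((*v) X)"
  define \<gamma> where "\<gamma> = \<alpha> / N\<^sup>2"
  define d where "d = v - v'"
  define p where "p = P v - P v'"
  have \<gamma>: "0 < \<gamma>" "\<gamma> * N\<^sup>2 = \<alpha>" using \<alpha> onorm_pos by (auto simp: \<gamma>_def N_def)
  have "norm (X *v p) \<le> N * norm p"
    unfolding N_def by (intro onorm matrix_vector_mul_bounded_linear)
  then have "(norm (X *v p))\<^sup>2 \<le> N\<^sup>2 * (norm p)\<^sup>2"
    using power_mono[of _ _ 2] by (fastforce simp: power_mult_distrib)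
  then have Xp: "\<gamma> * (norm (X *v p))\<^sup>2 \<le> \<alpha> * (norm p)\<^sup>2"
    using mult_left_mono[of _ _ \<gamma>] \<gamma> by (fastforce simp flip: mult.assoc)
  have "(norm (d + \<gamma> *\<^sub>R (X *v p)))\<^sup>2 = (norm d)\<^sup>2 + \<gamma> * (2 * (d \<bullet> (X *v p)) + \<gamma> * (norm (X *v p))\<^sup>2)"
    by (simp only: power2_norm_eq_inner)
      (simp add: inner_add_left inner_add_right inner_commute algebra_simps)
  also have "\<dots> \<le> (norm d)\<^sup>2 + \<gamma> * 0"
  proof (intro add_left_mono mult_left_mono)
    have "0 \<le> \<alpha> * (norm p)\<^sup>2" using \<alpha> by simp
    then show "2 * (d \<bullet> (X *v p)) + \<gamma> * (norm (X *v p))\<^sup>2 \<le> 0"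
      using primal_cocoercive[of v v'] Xp unfolding d_def p_def by linarith
  qed (use \<gamma> in simp)
  finally have "(norm (d + \<gamma> *\<^sub>R (X *v p)))\<^sup>2 \<le> (norm d)\<^sup>2" by simp
  then have "norm (d + \<gamma> *\<^sub>R (X *v p)) \<le> norm d" by (rule power2_le_imp_le) simp
  moreover have "dual_step R \<alpha> X y v - dual_step R \<alpha> X y v' = d + \<gamma> *\<^sub>R (X *v p)"
    unfolding dual_step_def d_def p_def matrix_vector_mult_diff_distrib scaleR_diff_right
    by (simp add: \<gamma>_def N_def)
  ultimately show ?thesis by (simp add: d_def)
qed

lemma continuous_dual_step: "continuous_on UNIV (dual_step R \<alpha> X y)"
proof (rule lipschitz_on_continuous_on)
  show "1-lipschitz_on UNIV (dual_step R \<alpha> X y)"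
    using dual_step_nonexpansive by (auto simp: lipschitz_on_def dist_norm)
qed

section \<open>Propagation of noise, and the limit of large \<theta>\<close>

lemma dgd_stability:
  "norm (dgd_v R \<alpha> X y k - dgd_v R \<alpha> X y' k) \<le> real k * (\<alpha> / (onorm ((*v) X))\<^sup>2 * norm (y - y'))"
proof (induction k)
  case (Suc k)
  let ?v = "dgd_v R \<alpha> X y k" and ?v' = "dgd_v R \<alpha> X y' k"
  \<comment> \<open>The intermediate point is the step at \<open>?v'\<close> with data
    \<open>y\<close>: one difference is old error, not amplified, the other is the fresh error of a
    single step.\<close>
  have "norm (dual_step R \<alpha> X y ?v - dual_step R \<alpha> X y' ?v')
      \<le> norm (dual_step R \<alpha> X y ?v - dual_step R \<alpha> X y ?v')
        + norm (dual_step R \<alpha> X y ?v' - dual_step R \<alpha> X y' ?v')"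
    by (rule order_trans[OF _ norm_triangle_ineq]) simp
  moreover have "norm (dual_step R \<alpha> X y ?v' - dual_step R \<alpha> X y' ?v')
      = \<alpha> / (onorm ((*v) X))\<^sup>2 * norm (y - y')"
    using \<alpha> by (simp add: dual_step_noise)
  moreover have "real (Suc k) * (\<alpha> / (onorm ((*v) X))\<^sup>2 * norm (y - y'))
      = real k * (\<alpha> / (onorm ((*v) X))\<^sup>2 * norm (y - y')) + \<alpha> / (onorm ((*v) X))\<^sup>2 * norm (y - y')"
    by (simp only: of_nat_Suc distrib_right mult_1_left add.commute)
  ultimately show ?case
    using Suc dual_step_nonexpansive[of y ?v ?v'] unfolding dgd_v.simps by linarith
qed simp

text \<open>For fixed \<open>k\<close> every momentum coefficient vanishes as \<theta> grows,
  including the initial \<open>- 1 / \<theta>\<close>, and continuity carries the limit through the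
  gradient step. The momentum involves two earlier iterates, hence the two-step induction.\<close>

lemma adgd_tendsto_dgd: "((\<lambda>\<theta>. adgd_v R \<alpha> X y \<theta> k) \<longlongrightarrow> dgd_v R \<alpha> X y k) at_top"
proof (induction k rule: induct_nat_012)
  case 0
  show ?case by simp
next
  case 1
  have "((\<lambda>\<theta>. (0 - 1) / (0 + \<theta>)) \<longlongrightarrow> (0::real)) at_top" by real_asymp
  then have "((\<lambda>\<theta>. adgd_v R \<alpha> X y \<theta> (Suc 0))
      \<longlongrightarrow> dual_step R \<alpha> X y 0 + 0 *\<^sub>R (dual_step R \<alpha> X y 0 - 0)) at_top"
    unfolding adgd_v.simps Let_def by (intro tendsto_intros)
  then show ?case by simp
next
  case (ge2 k)
  have step: "((\<lambda>\<theta>. dual_step R \<alpha> X y (adgd_v R \<alpha> X y \<theta> j))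
      \<longlongrightarrow> dual_step R \<alpha> X y (dgd_v R \<alpha> X y j)) at_top"
    if "((\<lambda>\<theta>. adgd_v R \<alpha> X y \<theta> j) \<longlongrightarrow> dgd_v R \<alpha> X y j) at_top" for j
    by (rule continuous_on_tendsto_compose[OF continuous_dual_step that]) auto
  have "((\<lambda>\<theta>. (real (Suc k) - 1) / (real (Suc k) + \<theta>)) \<longlongrightarrow> 0) at_top" by real_asymp
  then have "((\<lambda>\<theta>. adgd_v R \<alpha> X y \<theta> (Suc (Suc k)))
      \<longlongrightarrow> dual_step R \<alpha> X y (dgd_v R \<alpha> X y (Suc k))
        + 0 *\<^sub>R (dual_step R \<alpha> X y (dgd_v R \<alpha> X y (Suc k)) - dual_step R \<alpha> X y (dgd_v R \<alpha> X y k))) at_top"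
    unfolding adgd_v.simps Let_def by (intro tendsto_intros step ge2)
  then show ?case by simp
qed

text \<open>The index shifts by one because \<open>adgd_u\<close> already contains the gradient step
  at the \<open>k\<close>-th point.\<close>

lemma adgd_u_tendsto_dgd: "((\<lambda>\<theta>. adgd_u R \<alpha> X y \<theta> k) \<longlongrightarrow> dgd_v R \<alpha> X y (Suc k)) at_top"
  unfolding adgd_u_def dgd_v.simps
  by (rule continuous_on_tendsto_compose[OF continuous_dual_step adgd_tendsto_dgd]) auto

section \<open>Identification of the manifold near a dual point\<close>

lemma primal_unique:
  assumes w: "- (transpose X *v v) \<in> subdiff (regularized R \<alpha>) w"
  shows "P v = w"
proof -
  let ?z = "- (transpose X *v v)" and ?p = "P v"
  note proper = proper_regularized[OF R(1)]
  obtain a b where a: "regularized R \<alpha> ?p = ereal a" and b: "regularized R \<alpha> w = ereal b"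
    using subdiff_finite[OF proper primal_subdiff_regularized] subdiff_finite[OF proper w]
    by (metis ereal_cases abs_ereal.simps(2,3))
  \<comment> \<open>The plain subgradient inequality at \<open>w\<close> is added to the growth
    inequality at \<open>P v\<close>: the linear terms cancel and the quadratic gain is
    left.\<close>
  have "regularized R \<alpha> w + ereal (?z \<bullet> (?p - w)) \<le> regularized R \<alpha> ?p"
    using w by (simp only: subdiff_def mem_Collect_eq)
  then have "b + ?z \<bullet> (?p - w) \<le> a" unfolding a b by simp
  moreover have "a + (?z \<bullet> (w - ?p) + \<alpha> / 2 * (norm (w - ?p))\<^sup>2) \<le> b"
    using regularized_growth[OF primal_subdiff, of v w] unfolding a b by simp
  moreover have "?z \<bullet> (?p - w) = - (?z \<bullet> (w - ?p))" unfolding inner_diff_right by linarith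
  ultimately have "\<alpha> / 2 * (norm (w - ?p))\<^sup>2 \<le> 0" by linarith
  then show ?thesis using \<alpha> by (simp add: mult_le_0_iff)
qed

text \<open>The map \<open>G\<close> sends a dual point to its primal point plus the associated
  subgradient. It is continuous and sends \<open>v\<close> into the open interior of
  \<open>U_set\<close>, so nearby values are also sums based at points of \<open>M\<close>.\<close>

lemma primal_in_manifold_near:
  assumes v: "- (transpose X *v v) \<in> subdiff (regularized R \<alpha>) w"
    and int: "w - transpose X *v v \<in> interior (U_set R \<alpha> M w0 \<epsilon>)"
  obtains r where "0 < r" "\<And>v'. dist v' v < r \<Longrightarrow> P v' \<in> M"
proof -
  define G where "G v' = P v' - transpose X *v v'" for v'
  have "continuous_on UNIV G"
    unfolding G_def by (intro continuous_intros continuous_primal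
        linear_continuous_on matrix_vector_mul_bounded_linear)
  then have "isCont G v" by (simp add: continuous_on_eq_continuous_at)
  moreover have "G v \<in> interior (U_set R \<alpha> M w0 \<epsilon>)"
    using int by (simp add: G_def primal_unique[OF v])
  ultimately have "\<forall>\<^sub>F v' in nhds v. G v' \<in> interior (U_set R \<alpha> M w0 \<epsilon>)"
    using open_interior isCont_def tendsto_at_iff_tendsto_nhds topological_tendstoD by metis
  then obtain r where r: "0 < r" "\<And>v'. dist v' v < r \<Longrightarrow> G v' \<in> interior (U_set R \<alpha> M w0 \<epsilon>)"
    unfolding eventually_nhds_metric by blast
  have "P v' \<in> M" if "dist v' v < r" for v'
  proof -
    have "G v' \<in> U_set R \<alpha> M w0 \<epsilon>" using r(2)[OF that] interior_subset by blast
    then obtain x g where x: "x \<in> M" "g \<in> subdiff (regularized R \<alpha>) x" "G v' = x + g"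
      unfolding U_set_def by auto
    \<comment> \<open>\<open>G v'\<close> is decomposed in two ways as a point plus a subgradient
      there, and such a decomposition is unique.\<close>
    have "P v' = x"
      by (rule subdiff_add_inj[OF proper_regularized[OF R(1)] primal_subdiff_regularized x(2)])
        (use x(3) in \<open>simp add: G_def\<close>)
    then show ?thesis using x(1) by simp
  qed
  with r(1) that show ?thesis by blast
qed

end

section \<open>The distance condition and the choice of \<delta> and \<theta>\<close>

lemma pos_less_edist_set:
  assumes "ereal a < edist_set x S" "0 \<le> a"
  shows "x \<notin> S"
proof
  assume "x \<in> S"
  then have "edist_set x S \<le> ereal (dist x x)" unfolding edist_set_def by (rule INF_lower)
  also have "\<dots> \<le> ereal a" using assms(2) by simp
  finally show False using assms(1) by simp
qed

theorem corollary4p1: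
  fixes X :: "real^'p^'n" and R :: "real^'p \<Rightarrow> ereal"
    and wdag :: "real^'p" and ydag vdag :: "real^'n" and zdag :: "real^'p"
    and y :: "real \<Rightarrow> real^'n" and \<alpha> \<epsilon> c' :: real and M :: "(real^'p) set"
    and c cdel :: "real \<Rightarrow> real" and kDGD :: "real \<Rightarrow> nat"
  assumes X: "X \<noteq> 0"
    and R: "proper_fun R" "convex_fun R" "lsc_fun R"
    and \<alpha>: "\<alpha> > 0" and \<epsilon>: "\<epsilon> > 0" and c': "c' > 0"
    and ydag: "ydag = X *v wdag"
    and y0: "y 0 = ydag"
    and noise: "\<And>\<delta>. \<delta> \<in> {0<..<1} \<Longrightarrow> y \<delta> \<in> range ((*v) X) \<and> norm (y \<delta> - ydag) \<le> \<delta>"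
    and primal: "\<And>w. is_arg_min (regularized R \<alpha>) (\<lambda>w'. X *v w' = ydag) w \<longleftrightarrow> w = wdag"
    and dual: "is_arg_min (\<lambda>v. conjugate (regularized R \<alpha>) (- (transpose X *v v)) + ereal (ydag \<bullet> v))
                 (\<lambda>_. True) vdag"
    and conv: "dgd_v R \<alpha> X (y 0) \<longlonglongrightarrow> vdag"
    and zdag: "zdag = - (transpose X *v vdag)"
    and nondegenerate: "zdag \<in> rel_interior (subdiff (regularized R \<alpha>) wdag)"
    and smooth: "partly_smooth R wdag M"
    and kDGD: "\<And>\<delta>. \<delta> \<in> {0<..<1} \<Longrightarrow>
                 \<delta> \<le> c \<delta> \<and> kDGD \<delta> \<in> {nat \<lfloor>c \<delta> / \<delta>\<rfloor>..2 * nat \<lfloor>c \<delta> / \<delta>\<rfloor>}"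
    and cdel: "\<And>\<delta>. \<delta> \<in> {0<..<1} \<Longrightarrow> real (kDGD \<delta>) = cdel \<delta> / \<delta>"
  shows "\<exists>\<delta>\<^sub>0>0. \<forall>\<delta>. 0 < \<delta> \<and> \<delta> < 1 \<and> \<delta> < \<delta>\<^sub>0 \<and>
           ereal (\<alpha> * cdel \<delta> / onorm ((*v) X))
             < edist_set (wdag + zdag) (frontier (U_set R \<alpha> M wdag \<epsilon>)) \<longrightarrow>
         (\<exists>\<theta>\<^sub>\<delta>. \<forall>\<theta>. \<theta> > 2 \<and> \<theta> > \<theta>\<^sub>\<delta> \<longrightarrow>
            adgd_w R \<alpha> X (y \<delta>) \<theta> (adgd_stop c' \<delta>) \<in> M \<and>
            (\<exists>klo khi. 0 < klo \<and> klo < adgd_stop c' \<delta> \<and> adgd_stop c' \<delta> < khi \<and>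
               (\<forall>k. klo < k \<and> k < khi \<longrightarrow> adgd_w R \<alpha> X (y \<delta>) \<theta> k \<in> M)))"
proof (cases "wdag + zdag \<in> interior (U_set R \<alpha> M wdag \<epsilon>)")
  case False
  \<comment> \<open>The point lies in \<open>U_set\<close>; if it is not interior, it is on the
    frontier and its distance to the frontier is 0. The distance condition then fails for every
    \<delta> in the unit interval and the claim is vacuous. Interiority does not depend on \<delta>,
    so the case split can come first.\<close>
  have "wdag + zdag \<in> U_set R \<alpha> M wdag \<epsilon>"
    using smooth \<epsilon> nondegenerate rel_interior_subset by (fastforce simp: partly_smooth_def U_set_def)
  then have "wdag + zdag \<in> frontier (U_set R \<alpha> M wdag \<epsilon>)"
    using False closure_subset by (auto simp: frontier_def)
  \<comment> \<open>\<open>cdel \<delta>\<close> is \<delta> times a natural number, so the left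
    side of the distance condition cannot be negative.\<close>
  moreover have "0 \<le> \<alpha> * cdel \<delta> / onorm ((*v) X)" if "\<delta> \<in> {0<..<1}" for \<delta>
  proof -
    have "0 \<le> cdel \<delta> / \<delta>" using cdel[OF that] by (metis of_nat_0_le_iff)
    then have "0 \<le> cdel \<delta>" using that by (simp add: zero_le_divide_iff)
    then show ?thesis using \<alpha> onorm_pos_le[of "(*v) X"] by (simp add: matrix_vector_mul_bounded_linear)
  qed
  ultimately show ?thesis
    using pos_less_edist_set by (intro exI[of _ 1]) fastforce
next
  case True
  obtain s where "s \<in> subdiff R wdag" using smooth by (auto simp: partly_smooth_def)
  then interpret dual_problem R \<alpha> X s wdag using R \<alpha> X by unfold_locales
  obtain r where r: "0 < r" "\<And>v. dist v vdag < r \<Longrightarrow> P v \<in> M"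
    using primal_in_manifold_near[of vdag wdag M wdag \<epsilon>] True nondegenerate rel_interior_subset
    unfolding zdag by auto
  define \<gamma> where "\<gamma> = \<alpha> / (onorm ((*v) X))\<^sup>2"
  have \<gamma>: "0 \<le> \<gamma>" using \<alpha> by (simp add: \<gamma>_def)
  \<comment> \<open>Half of the radius \<open>r\<close> is spent on noiseless convergence, the other
    half on noise.\<close>
  obtain K where K: "\<And>k. k \<ge> K \<Longrightarrow> dist (dgd_v R \<alpha> X ydag k) vdag < r / 2"
    using metric_LIMSEQ_D[OF conv, of "r / 2"] r(1) unfolding y0 by auto
  have lim1: "filterlim (\<lambda>\<delta>::real. c' * \<delta> powr (-1/2)) at_top (at_right 0)"
    using c' by real_asymp
  \<comment> \<open>The stopping time is at most \<open>c' * \<delta> powr (-1/2) + 1\<close> and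
    one more gradient step is taken, hence the summand 2. The product bounds the accumulated noise
    and is of order square root of \<delta>.\<close>
  have lim2: "((\<lambda>\<delta>::real. (c' * \<delta> powr (-1/2) + 2) * (\<gamma> * \<delta>)) \<longlongrightarrow> 0) (at_right 0)"
    using c' by real_asymp
  \<comment> \<open>Exceeding \<open>K\<close> brings the noiseless iterate close to
    \<open>vdag\<close>; exceeding 1 makes the stopping time at least 2, which leaves room for a
    positive integer below it.\<close>
  have "\<forall>\<^sub>F \<delta> in at_right 0. c' * \<delta> powr (-1/2) > max (real K) 1"
    using lim1 unfolding filterlim_at_top_dense by blast
  moreover have "\<forall>\<^sub>F \<delta> in at_right 0. (c' * \<delta> powr (-1/2) + 2) * (\<gamma> * \<delta>) < r / 2"
    using order_tendstoD(2)[OF lim2, of "r / 2"] r(1) by simp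
  ultimately have "\<forall>\<^sub>F \<delta> in at_right 0. c' * \<delta> powr (-1/2) > max (real K) 1 \<and>
      (c' * \<delta> powr (-1/2) + 2) * (\<gamma> * \<delta>) < r / 2"
    by (rule eventually_conj)
  then obtain \<delta>0 where \<delta>0: "0 < \<delta>0" "\<And>\<delta>. 0 < \<delta> \<Longrightarrow> \<delta> < \<delta>0 \<Longrightarrow>
      c' * \<delta> powr (-1/2) > max (real K) 1 \<and> (c' * \<delta> powr (-1/2) + 2) * (\<gamma> * \<delta>) < r / 2"
    unfolding eventually_at_right_field by blast
  have main: "2 \<le> adgd_stop c' \<delta> \<and>
      (\<exists>\<theta>\<^sub>\<delta>. \<forall>\<theta>>\<theta>\<^sub>\<delta>. adgd_w R \<alpha> X (y \<delta>) \<theta> (adgd_stop c' \<delta>) \<in> M)"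
    if \<delta>: "0 < \<delta>" "\<delta> < 1" "\<delta> < \<delta>0" for \<delta>
  proof -
    define k where "k = adgd_stop c' \<delta>"
    have big: "c' * \<delta> powr (-1/2) > max (real K) 1"
      and small: "(c' * \<delta> powr (-1/2) + 2) * (\<gamma> * \<delta>) < r / 2"
      using \<delta>0(2) \<delta> by auto
    have k: "c' * \<delta> powr (-1/2) \<le> real k" "real k \<le> c' * \<delta> powr (-1/2) + 1"
      using big unfolding k_def adgd_stop_def by linarith+
    have "dist (dgd_v R \<alpha> X (y \<delta>) (Suc k)) (dgd_v R \<alpha> X ydag (Suc k))
        \<le> real (Suc k) * (\<gamma> * norm (y \<delta> - ydag))"
      using dgd_stability unfolding dist_norm \<gamma>_def .
    also have "\<dots> \<le> (c' * \<delta> powr (-1/2) + 2) * (\<gamma> * \<delta>)"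
      using k(2) noise[of \<delta>] \<delta> \<gamma> by (intro mult_mono) auto
    finally have "dist (dgd_v R \<alpha> X (y \<delta>) (Suc k)) vdag < r"
      using small K[of "Suc k"] k(1) big dist_triangle_half_l[of _ _ r vdag]
      by (smt (verit) dist_triangle field_sum_of_halves of_nat_le_iff of_nat_Suc max.cobounded1)
    \<comment> \<open>Here \<delta> and \<open>k\<close> are fixed and only \<theta> grows, so the
      resulting threshold \<open>T\<close> may depend on \<delta>.\<close>
    then have "\<forall>\<^sub>F \<theta> in at_top. dist (adgd_u R \<alpha> X (y \<delta>) \<theta> k) vdag < r"
      using order_tendstoD(2)[OF tendsto_dist[OF adgd_u_tendsto_dgd tendsto_const]] by blast
    then have "\<forall>\<^sub>F \<theta> in at_top. adgd_w R \<alpha> X (y \<delta>) \<theta> k \<in> M"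
      by eventually_elim (simp add: adgd_w_def r(2))
    then obtain T where "\<forall>\<theta>>T. adgd_w R \<alpha> X (y \<delta>) \<theta> k \<in> M"
      unfolding eventually_at_top_dense by blast
    moreover have "2 \<le> k" using k(1) big by linarith
    ultimately show ?thesis unfolding k_def by blast
  qed
  show ?thesis
  proof (rule exI[of _ \<delta>0], rule conjI[OF \<delta>0(1)], rule allI, rule impI, elim conjE)
    fix \<delta> assume \<delta>: "0 < \<delta>" "\<delta> < 1" "\<delta> < \<delta>0"
    define k where "k = adgd_stop c' \<delta>"
    have "2 \<le> k" and "\<exists>\<theta>\<^sub>\<delta>. \<forall>\<theta>>\<theta>\<^sub>\<delta>. adgd_w R \<alpha> X (y \<delta>) \<theta> k \<in> M"
      using main[OF \<delta>] unfolding k_def by auto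
    then obtain T where T: "\<And>\<theta>. \<theta> > T \<Longrightarrow> adgd_w R \<alpha> X (y \<delta>) \<theta> k \<in> M" by blast
    \<comment> \<open>The witnesses are \<open>k - 1\<close> and \<open>k + 1\<close>: the only
      natural number strictly between them is \<open>k\<close>, and \<open>2 \<le> k\<close> keeps
      the lower one positive.\<close>
    have "0 < k - 1 \<and> k - 1 < k \<and> k < k + 1 \<and>
        (\<forall>j. k - 1 < j \<and> j < k + 1 \<longrightarrow> adgd_w R \<alpha> X (y \<delta>) \<theta> j \<in> M)" if "\<theta> > T" for \<theta>
    proof -
      have "j = k" if "k - 1 < j" "j < k + 1" for j using that by linarith
      then show ?thesis using T[OF that] \<open>2 \<le> k\<close> by auto
    qed
    then show "\<exists>\<theta>\<^sub>\<delta>. \<forall>\<theta>. \<theta> > 2 \<and> \<theta> > \<theta>\<^sub>\<delta> \<longrightarrow>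
        adgd_w R \<alpha> X (y \<delta>) \<theta> (adgd_stop c' \<delta>) \<in> M \<and>
        (\<exists>klo khi. 0 < klo \<and> klo < adgd_stop c' \<delta> \<and> adgd_stop c' \<delta> < khi \<and>
           (\<forall>j. klo < j \<and> j < khi \<longrightarrow> adgd_w R \<alpha> X (y \<delta>) \<theta> j \<in> M))"
      unfolding k_def[symmetric] using T by blast
  qed
qed

end
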